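(* Let $T>0$, $d\ge1$, and let $g:\mathbb{R}^d\to\mathbb{R}$ be Lipschitz-continuous. Let $\varphi^\varepsilon$ and $\varphi^0$ be the solutions, with terminal condition $g$, of the viscous and first-order Hamilton-Jacobi equations with Hamiltonian $\frac12|p|^2$ (see context). There exists $C>0$ depending only on $(\|\nabla g\|_{L^\infty},T,d)$ such that for every $\varepsilon\in(0,1/2]$, $$\forall (t,x)\in[0,T]\times\mathbb{R}^d,\qquad \varphi^\varepsilon_t(x)-\varphi^0_t(x)\le-\frac d2\,\varepsilon\log\varepsilon+C\varepsilon .$$
   Context: For $\varepsilon>0$, $\varphi^\varepsilon$ is the unique classical ($\mathcal{C}^{1,2}$ on $[0,T)\times\mathbb{R}^d$, continuous up to $t=T$) solution with bounded gradient of $$-\partial_t\varphi^\varepsilon_t(x)+\frac12|\nabla\varphi^\varepsilon_t(x)|^2=\frac\varepsilon2\Delta\varphi^\varepsilon_t(x),\qquad \varphi^\varepsilon_T=g,$$ and $\varphi^0$ is the unique Lipschitz-continuous viscosity solution of $$-\partial_t\varphi^0_t(x)+\frac12|\nabla\varphi^0_t(x)|^2=0,\qquad \varphi^0_T=g.$$ *)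

theory Defs
  imports "HOL-Analysis.Analysis" "HOL-Probability.Essential_Supremum"
begin

definition gradient :: "('a::euclidean_space \<Rightarrow> real) \<Rightarrow> 'a \<Rightarrow> 'a" where
  "gradient f x = (THE D. GDERIV f x :> D)"

text \<open>
  The \<open>L\<^sup>\<infinity>\<close> norm of the gradient of a Lipschitz function. By Rademacher's theorem the
  points without a gradient form a null set, so the value \<open>\<infinity>\<close> assigned there does
  not affect the essential supremum.
\<close>

definition grad_Linf :: "('a::euclidean_space \<Rightarrow> real) \<Rightarrow> ereal" where
  "grad_Linf f = esssup lebesgue
     (\<lambda>x. if \<exists>D. GDERIV f x :> D then ereal (norm (gradient f x)) else \<infinity>)"

text \<open>
  \<open>dt\<close>, \<open>G\<close>, \<open>H\<close> are the time derivative, spatial gradient and spatial Hessian of \<open>\<phi>\<close> on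
  \<open>[0,T) \<times> \<real>\<^sup>d\<close> (the time derivative being one-sided at \<open>t = 0\<close>), and all of them are
  jointly continuous there.
\<close>

definition has_C12_derivs ::
  "real \<Rightarrow> (real \<Rightarrow> 'a::euclidean_space \<Rightarrow> real) \<Rightarrow> (real \<Rightarrow> 'a \<Rightarrow> real)
    \<Rightarrow> (real \<Rightarrow> 'a \<Rightarrow> 'a) \<Rightarrow> (real \<Rightarrow> 'a \<Rightarrow> 'a \<Rightarrow>\<^sub>L 'a) \<Rightarrow> bool" where
  "has_C12_derivs T \<phi> dt G H \<longleftrightarrow>
     (\<forall>t\<in>{0..<T}. \<forall>x.
        ((\<lambda>s. \<phi> s x) has_real_derivative dt t x) (at t within {0..<T}) \<and>
        (GDERIV (\<phi> t) x :> G t x) \<and>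
        (G t has_derivative blinfun_apply (H t x)) (at x)) \<and>
     continuous_on ({0..<T} \<times> UNIV) (\<lambda>(t, x). dt t x) \<and>
     continuous_on ({0..<T} \<times> UNIV) (\<lambda>(t, x). G t x) \<and>
     continuous_on ({0..<T} \<times> UNIV) (\<lambda>(t, x). H t x)"

definition viscous_HJ_solution ::
  "real \<Rightarrow> real \<Rightarrow> ('a::euclidean_space \<Rightarrow> real) \<Rightarrow> (real \<Rightarrow> 'a \<Rightarrow> real) \<Rightarrow> bool" where
  "viscous_HJ_solution \<epsilon> T g \<phi> \<longleftrightarrow>
     continuous_on ({0..T} \<times> UNIV) (\<lambda>(t, x). \<phi> t x) \<and>
     (\<forall>x. \<phi> T x = g x) \<and>
     (\<exists>dt G H. has_C12_derivs T \<phi> dt G H \<and>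
        (\<exists>B. \<forall>t\<in>{0..<T}. \<forall>x. norm (G t x) \<le> B) \<and>
        (\<forall>t\<in>{0..<T}. \<forall>x.
           - dt t x + 1/2 * (norm (G t x))\<^sup>2 = \<epsilon>/2 * (\<Sum>b\<in>Basis. H t x b \<bullet> b)))"

text \<open>Test functions: \<open>C\<^sup>1\<close> on \<open>(0,T) \<times> \<real>\<^sup>d\<close>, with derivatives \<open>dt\<close> and \<open>G\<close>.\<close>

definition has_C1_derivs ::
  "real \<Rightarrow> (real \<times> 'a::euclidean_space \<Rightarrow> real) \<Rightarrow> (real \<times> 'a \<Rightarrow> real)
    \<Rightarrow> (real \<times> 'a \<Rightarrow> 'a) \<Rightarrow> bool" where
  "has_C1_derivs T \<psi> dt G \<longleftrightarrow>
     (\<forall>z\<in>{0<..<T} \<times> UNIV. GDERIV \<psi> z :> (dt z, G z)) \<and>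
     continuous_on ({0<..<T} \<times> UNIV) dt \<and>
     continuous_on ({0<..<T} \<times> UNIV) G"

text \<open>
  Viscosity sub- and supersolutions of \<open>- \<partial>\<^sub>t u + |\<nabla>u|\<^sup>2 / 2 = 0\<close> on \<open>(0,T) \<times> \<real>\<^sup>d\<close>. The sign of
  the equation matters: this is the form obtained from
  \<open>- \<partial>\<^sub>t u + |\<nabla>u|\<^sup>2 / 2 = \<epsilon> / 2 \<Delta>u\<close> in the limit \<open>\<epsilon> \<rightarrow> 0\<close>. The functions to which they
  are applied below are continuous, so no semicontinuity is built in.
\<close>

definition viscosity_subsolution ::
  "real \<Rightarrow> (real \<times> 'a::euclidean_space \<Rightarrow> real) \<Rightarrow> bool" where
  "viscosity_subsolution T u \<longleftrightarrow>
     (\<forall>\<psi> dt G. has_C1_derivs T \<psi> dt G \<longrightarrow>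
        (\<forall>z\<in>{0<..<T} \<times> UNIV.
           (\<forall>\<^sub>F w in nhds z. u w - \<psi> w \<le> u z - \<psi> z) \<longrightarrow>
           - dt z + 1/2 * (norm (G z))\<^sup>2 \<le> 0))"

definition viscosity_supersolution ::
  "real \<Rightarrow> (real \<times> 'a::euclidean_space \<Rightarrow> real) \<Rightarrow> bool" where
  "viscosity_supersolution T u \<longleftrightarrow>
     (\<forall>\<psi> dt G. has_C1_derivs T \<psi> dt G \<longrightarrow>
        (\<forall>z\<in>{0<..<T} \<times> UNIV.
           (\<forall>\<^sub>F w in nhds z. u w - \<psi> w \<ge> u z - \<psi> z) \<longrightarrow>
           - dt z + 1/2 * (norm (G z))\<^sup>2 \<ge> 0))"

definition HJ_viscosity_solution ::
  "real \<Rightarrow> ('a::euclidean_space \<Rightarrow> real) \<Rightarrow> (real \<Rightarrow> 'a \<Rightarrow> real) \<Rightarrow> bool" where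
  "HJ_viscosity_solution T g \<phi> \<longleftrightarrow>
     (\<exists>K. K-lipschitz_on ({0..T} \<times> UNIV) (\<lambda>(t, x). \<phi> t x)) \<and>
     (\<forall>x. \<phi> T x = g x) \<and>
     viscosity_subsolution T (\<lambda>(t, x). \<phi> t x) \<and>
     viscosity_supersolution T (\<lambda>(t, x). \<phi> t x)"

end

theory Submission
  imports Defs
begin

text \<open>
  On one side, comparison with a time-delayed heat kernel: since \<open>g z \<le> g y + L |z - y|\<close>, the
  function
  \<open>g y + |x - y|\<^sup>2 / (2 (T - t + \<epsilon>)) + d \<epsilon> / 2 ln ((T - t + \<epsilon>) / \<epsilon>) + L\<^sup>2 \<epsilon> / 2\<close>
  solves the viscous equation and lies above \<open>g\<close> at \<open>t = T\<close>, hence above \<open>\<phi>\<epsilon>\<close>; the logarithm is the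
  source of \<open>- d / 2 \<epsilon> ln \<epsilon>\<close>. On the other side, \<open>\<phi>0\<close> lies above the Hopf--Lax infimum
  of \<open>g y + |x - y|\<^sup>2 / (2 (T - t))\<close>, as one sees by testing the supersolution property at
  \<open>(s, z)\<close> with \<open>- |z - x|\<^sup>2 / (2 (s - t))\<close>. Using the same \<open>y\<close> in both bounds gives the claim.
\<close>

section \<open>Maxima of coercive functions and derivative tests along lines\<close>

text \<open>Far from \<open>y\<close> the quadratic term pushes \<open>F\<close> below its value at
  \<open>(b, y)\<close>, so a maximum over a large compact cylinder is already global. It provides
  the contact points for both comparison arguments.\<close>

lemma coercive_attains_sup:
  fixes F :: "real \<times> 'a::euclidean_space \<Rightarrow> real"
  assumes cont: "continuous_on ({a..b} \<times> UNIV) F" and "a \<le> b" and "c > 0"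
    and bound: "\<And>t x. t \<in> {a..b} \<Longrightarrow> F (t, x) \<le> A + B * norm (x - y) - c * (norm (x - y))\<^sup>2"
  shows "\<exists>t0\<in>{a..b}. \<exists>x0. \<forall>t\<in>{a..b}. \<forall>x. F (t, x) \<le> F (t0, x0)"
proof -
  \<comment> \<open>For \<open>r \<ge> R\<close> one has
    \<open>c * r \<ge> \<bar>B\<bar> + \<bar>A - F (b, y)\<bar>\<close>. The summand
    \<open>1\<close> ensures \<open>r \<ge> 1\<close>, so that the constant term can also be
    absorbed after multiplying by \<open>r\<close>.\<close>
  define R where "R = (\<bar>B\<bar> + \<bar>A - F (b, y)\<bar>) / c + 1"
  have "R \<ge> 1"
    using \<open>c > 0\<close> by (simp add: R_def)
  have "compact ({a..b} \<times> cball y R)"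
    by (intro compact_Times) auto
  moreover have "{a..b} \<times> cball y R \<noteq> {}"
    using \<open>a \<le> b\<close> \<open>R \<ge> 1\<close> by auto
  moreover have "continuous_on ({a..b} \<times> cball y R) F"
    by (rule continuous_on_subset[OF cont]) auto
  ultimately obtain z where z: "z \<in> {a..b} \<times> cball y R"
    "\<And>w. w \<in> {a..b} \<times> cball y R \<Longrightarrow> F w \<le> F z"
    using continuous_attains_sup[of "{a..b} \<times> cball y R" F] by metis
  obtain t0 x0 where [simp]: "z = (t0, x0)"
    by (cases z)
  have "F (t, x) \<le> F (t0, x0)" if "t \<in> {a..b}" for t x
  proof (cases "dist y x \<le> R")
    case True
    then show ?thesis using z(2)[of "(t, x)"] that by simp
  next
    case False
    define r where "r = norm (x - y)"
    have "r \<ge> R" "r \<ge> 1"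
      using False \<open>R \<ge> 1\<close> by (auto simp: r_def dist_norm norm_minus_commute)
    have "\<bar>B\<bar> + \<bar>A - F (b, y)\<bar> \<le> c * R"
      using \<open>c > 0\<close> by (simp add: R_def field_simps)
    also have "\<dots> \<le> c * r"
      using \<open>c > 0\<close> \<open>r \<ge> R\<close> by simp
    finally have "(\<bar>B\<bar> + \<bar>A - F (b, y)\<bar>) * r \<le> c * r * r"
      using \<open>r \<ge> 1\<close> by (intro mult_right_mono) auto
    moreover have "\<bar>A - F (b, y)\<bar> * 1 \<le> \<bar>A - F (b, y)\<bar> * r"
      using \<open>r \<ge> 1\<close> by (intro mult_left_mono) auto
    moreover have "B * r \<le> \<bar>B\<bar> * r"
      using \<open>r \<ge> 1\<close> by (intro mult_right_mono) auto
    ultimately have "A + B * r - c * r\<^sup>2 \<le> F (b, y)"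
      by (simp add: power2_eq_square algebra_simps)
    also have "\<dots> \<le> F (t0, x0)"
      using z(2)[of "(b, y)"] \<open>a \<le> b\<close> \<open>R \<ge> 1\<close> by simp
    finally show ?thesis
      using bound[OF that, of x] by (simp add: r_def)
  qed
  with z(1) show ?thesis
    by (intro bexI[of _ t0] exI[of _ x0]) auto
qed

text \<open>If \<open>l\<close> were positive, \<open>f'\<close> would be positive just to the right
  of \<open>0\<close> and \<open>f\<close> would exceed \<open>f 0\<close> there. Differentiability
  of \<open>f'\<close> is asked at \<open>0\<close> alone, which is what the Hessian at a single
  point supplies along a line.\<close>

lemma second_derivative_nonpos_at_max:
  fixes f f' :: "real \<Rightarrow> real"
  assumes f: "\<And>r. (f has_real_derivative f' r) (at r)"
    and f': "(f' has_real_derivative l) (at 0)"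
    and max: "\<And>r. f r \<le> f 0"
  shows "f' 0 = 0" "l \<le> 0"
proof -
  show 0: "f' 0 = 0"
    by (rule DERIV_local_max[OF f zero_less_one]) (use max in auto)
  show "l \<le> 0"
  proof (rule ccontr)
    assume "\<not> l \<le> 0"
    then obtain d where d: "d > 0" "\<And>h. 0 < h \<Longrightarrow> h < d \<Longrightarrow> f' 0 < f' (0 + h)"
      using DERIV_pos_inc_right[OF f'] by (auto simp: not_le)
    have "f 0 < f (d / 2)"
    proof (rule DERIV_pos_imp_increasing_open[where f = f])
      show "0 < d / 2" using d(1) by simp
      show "\<exists>y. (f has_real_derivative y) (at r) \<and> 0 < y" if "0 < r" "r < d / 2" for r
        using f[of r] d(2)[of r] 0 that by auto
      show "continuous_on {0..d / 2} f"
        using f by (intro continuous_at_imp_continuous_on) (blast intro: DERIV_isCont)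
    qed
    with max[of "d / 2"] show False by simp
  qed
qed

lemma GDERIV_along_line:
  fixes f :: "'a::euclidean_space \<Rightarrow> real"
  assumes "GDERIV f (x + r *\<^sub>R h) :> D"
  shows "((\<lambda>r. f (x + r *\<^sub>R h)) has_real_derivative D \<bullet> h) (at r)"
proof -
  have "((\<lambda>r. x + r *\<^sub>R h) has_derivative (\<lambda>k. k *\<^sub>R h)) (at r)"
    by (auto intro!: derivative_eq_intros)
  then have "((\<lambda>r. f (x + r *\<^sub>R h)) has_derivative (\<lambda>k. (k *\<^sub>R h) \<bullet> D)) (at r)"
    by (rule has_derivative_compose) (use assms in \<open>simp add: gderiv_def\<close>)
  moreover have "(\<lambda>k. (k *\<^sub>R h) \<bullet> D) = (*) (D \<bullet> h)"
    by (simp add: fun_eq_iff inner_commute)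
  ultimately show ?thesis
    by (simp add: has_field_derivative_def)
qed

lemma bounded_gradient_lipschitz:
  fixes f :: "'a::euclidean_space \<Rightarrow> real"
  assumes "\<And>x. GDERIV f x :> G x" and "\<And>x. norm (G x) \<le> B"
  shows "\<bar>f x - f y\<bar> \<le> B * norm (x - y)"
proof -
  have "norm (f x - f y) \<le> B * norm (x - y)"
  proof (rule differentiable_bound[of UNIV f "\<lambda>x h. h \<bullet> G x"])
    fix z
    show "onorm (\<lambda>h. h \<bullet> G z) \<le> B"
    proof (rule onorm_le)
      fix h
      show "norm (h \<bullet> G z) \<le> B * norm h"
        using Cauchy_Schwarz_ineq2[of h "G z"] mult_left_mono[OF assms(2)[of z], of "norm h"]
        by (simp add: mult.commute)
    qed
  qed (use assms(1) in \<open>auto simp: gderiv_def\<close>)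
  then show ?thesis by simp
qed

section \<open>Upper bound for the viscous solution\<close>

text \<open>
  The right-hand side is an exact solution of the viscous equation, namely the Hopf--Cole
  transform of a heat kernel with pole at \<open>y\<close>, delayed by time \<open>\<epsilon>\<close> to be smooth up to \<open>T\<close>.
\<close>

lemma viscous_HJ_solution_le_heat_kernel:
  fixes g :: "'a::euclidean_space \<Rightarrow> real"
  assumes sol: "viscous_HJ_solution \<epsilon> T g \<phi>" and "T > 0" "\<epsilon> > 0"
    and lip: "\<And>x y. g x - g y \<le> L * dist x y"
    and t: "t \<in> {0..T}"
  shows "\<phi> t x \<le> g y + (norm (x - y))\<^sup>2 / (2 * (T - t + \<epsilon>))
    + \<epsilon> * real DIM('a) / 2 * ln ((T - t + \<epsilon>) / \<epsilon>) + L\<^sup>2 * \<epsilon> / 2"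
proof -
  define d where "d = real DIM('a)"
  define w where "w = (\<lambda>s z. g y + (norm (z - y))\<^sup>2 / (2 * (T - s + \<epsilon>))
    + \<epsilon> * d / 2 * ln ((T - s + \<epsilon>) / \<epsilon>) + L\<^sup>2 * \<epsilon> / 2)"
  from sol obtain dt G H B where cont: "continuous_on ({0..T} \<times> UNIV) (\<lambda>(t, x). \<phi> t x)"
    and terminal: "\<And>x. \<phi> T x = g x"
    and derivs: "has_C12_derivs T \<phi> dt G H"
    and B: "\<And>t x. t \<in> {0..<T} \<Longrightarrow> norm (G t x) \<le> B"
    and pde: "\<And>t x. t \<in> {0..<T} \<Longrightarrow>
      - dt t x + 1/2 * (norm (G t x))\<^sup>2 = \<epsilon>/2 * (\<Sum>b\<in>Basis. H t x b \<bullet> b)"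
    unfolding viscous_HJ_solution_def by blast
  have phit: "((\<lambda>s. \<phi> s x) has_real_derivative dt t x) (at t within {0..<T})"
    and phix: "GDERIV (\<phi> t) x :> G t x"
    and phixx: "(G t has_derivative blinfun_apply (H t x)) (at x)" if "t \<in> {0..<T}" for t x
    using derivs that by (auto simp: has_C12_derivs_def)

  have "continuous_on {0..T} (\<lambda>s. \<phi> s y)"
    by (rule continuous_on_compose2[OF cont, of _ "\<lambda>s. (s, y)", simplified])
      (auto intro!: continuous_intros)
  then obtain m where m: "\<And>s. s \<in> {0..T} \<Longrightarrow> \<phi> s y \<le> m"
    using continuous_attains_sup[of "{0..T}" "\<lambda>s. \<phi> s y"] \<open>T > 0\<close> by fastforce
  \<comment> \<open>Linear growth uniform in time, to be beaten by the quadratic term of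
    \<open>w\<close>. The gradient bound \<open>B\<close> covers \<open>s < T\<close> only; at
    \<open>s = T\<close> the constant \<open>L\<close> of \<open>g\<close> takes over, hence
    \<open>max B L\<close>.\<close>
  have growth: "\<phi> s z \<le> m + max B L * norm (z - y)" if s: "s \<in> {0..T}" for s z
  proof -
    have "\<phi> s z - \<phi> s y \<le> max B L * norm (z - y)"
    proof (cases "s = T")
      case True
      have "g z - g y \<le> L * norm (z - y)"
        using lip[of z y] by (simp add: dist_norm)
      also have "\<dots> \<le> max B L * norm (z - y)"
        by (intro mult_right_mono) auto
      finally show ?thesis by (simp add: True terminal)
    next
      case False
      with s have "s \<in> {0..<T}" by auto
      then have "\<bar>\<phi> s z - \<phi> s y\<bar> \<le> B * norm (z - y)"
        by (intro bounded_gradient_lipschitz[of _ "G s"] phix B)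
      also have "\<dots> \<le> max B L * norm (z - y)"
        by (intro mult_right_mono) auto
      finally show ?thesis by simp
    qed
    with m[OF s] show ?thesis by simp
  qed

  \<comment> \<open>Adding \<open>\<eta> * (T - s)\<close> turns the exact solution \<open>w\<close>
    into a strict supersolution, so the difference cannot have its maximum before time
    \<open>T\<close>; afterwards \<open>\<eta>\<close> tends to \<open>0\<close>.\<close>
  have strict: "\<phi> t x \<le> w t x + \<eta> * T" if "\<eta> > 0" for \<eta> :: real
  proof -
    define F where "F = (\<lambda>(s, z). \<phi> s z - w s z - \<eta> * (T - s))"
    have contF: "continuous_on ({0..T} \<times> UNIV) F"
      using cont \<open>\<epsilon> > 0\<close> unfolding F_def w_def case_prod_unfold
      by (auto intro!: continuous_intros)
    have boundF: "F (s, z) \<le> (m - g y - L\<^sup>2 * \<epsilon> / 2) + max B L * norm (z - y)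
        - 1 / (2 * (T + \<epsilon>)) * (norm (z - y))\<^sup>2" if s: "s \<in> {0..T}" for s z
    proof -
      have "1 / (2 * (T + \<epsilon>)) * (norm (z - y))\<^sup>2 \<le> (norm (z - y))\<^sup>2 / (2 * (T - s + \<epsilon>))"
        using s \<open>\<epsilon> > 0\<close> by (simp add: divide_left_mono mult_pos_pos add_nonneg_pos)
      moreover have "0 \<le> \<epsilon> * d / 2 * ln ((T - s + \<epsilon>) / \<epsilon>)"
        using s \<open>\<epsilon> > 0\<close> by (intro mult_nonneg_nonneg ln_ge_zero) (auto simp: d_def)
      moreover have "0 \<le> \<eta> * (T - s)"
        using s \<open>\<eta> > 0\<close> by simp
      ultimately show ?thesis
        using growth[OF s, of z] unfolding F_def w_def by simp
    qed
    have pos: "0 \<le> T" "0 < 1 / (2 * (T + \<epsilon>))"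
      using \<open>T > 0\<close> \<open>\<epsilon> > 0\<close> by auto
    obtain t0 x0 where t0: "t0 \<in> {0..T}"
      and max: "\<And>s z. s \<in> {0..T} \<Longrightarrow> F (s, z) \<le> F (t0, x0)"
      using coercive_attains_sup[OF contF pos boundF] by blast
    have "t0 = T"
    proof (rule ccontr)
      assume "t0 \<noteq> T"
      with t0 have t0': "t0 \<in> {0..<T}" by auto
      define s0 where "s0 = T - t0 + \<epsilon>"
      have "s0 > 0" using t0 \<open>\<epsilon> > 0\<close> by (simp add: s0_def)
      \<comment> \<open>This is the time derivative of \<open>w\<close> at \<open>(t0, x0)\<close>.
        It equals half the squared gradient, with gradient \<open>(x0 - y) /\<^sub>R s0\<close>,
        minus \<open>\<epsilon> / 2\<close> times the Laplacian \<open>d / s0\<close>: the viscous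
        equation for \<open>w\<close>.\<close>
      define wt where "wt = (norm (x0 - y))\<^sup>2 / (2 * s0\<^sup>2) - \<epsilon> * d / (2 * s0)"
      have d1: "((\<lambda>s. (norm (x0 - y))\<^sup>2 / (2 * (T - s + \<epsilon>))) has_real_derivative
          (norm (x0 - y))\<^sup>2 / (2 * s0\<^sup>2)) (at t0 within {0..<T})"
      proof -
        have "2 * T - 2 * t0 + 2 * \<epsilon> = 2 * s0"
          by (simp add: s0_def)
        with \<open>s0 > 0\<close> show ?thesis
          by (auto intro!: derivative_eq_intros simp: power2_eq_square)
      qed
      have d2: "((\<lambda>s. \<epsilon> * d / 2 * ln ((T - s + \<epsilon>) / \<epsilon>)) has_real_derivative
          - \<epsilon> * d / (2 * s0)) (at t0 within {0..<T})"
        using \<open>s0 > 0\<close> \<open>\<epsilon> > 0\<close>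
        by (auto intro!: derivative_eq_intros simp: s0_def[symmetric])
      have deriv_t: "((\<lambda>s. F (s, x0)) has_real_derivative dt t0 x0 - wt + \<eta>)
          (at t0 within {0..<T})"
        unfolding F_def w_def prod.case
        by (rule DERIV_cong[OF DERIV_diff[OF DERIV_diff[OF phit[OF t0']
                DERIV_add[OF DERIV_add[OF DERIV_add[OF DERIV_const d1] d2] DERIV_const]]
              DERIV_cmult[OF DERIV_diff[OF DERIV_const DERIV_ident]]]])
          (simp add: wt_def)
      \<comment> \<open>The maximum may lie at \<open>t0 = 0\<close>, where only forward increments
        are available. They give an inequality in place of a vanishing derivative, and its sign is
        the useful one.\<close>
      have time: "dt t0 x0 - wt + \<eta> \<le> 0"
      proof (rule ccontr)
        assume "\<not> ?thesis"
        then obtain e where e: "e > 0"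
          "\<And>h. 0 < h \<Longrightarrow> t0 + h \<in> {0..<T} \<Longrightarrow> h < e \<Longrightarrow> F (t0, x0) < F (t0 + h, x0)"
          using has_real_derivative_pos_inc_right[OF deriv_t]
          by (auto simp: not_le)
        define h where "h = min (e / 2) ((T - t0) / 2)"
        have "0 < h" "t0 + h \<in> {0..<T}" "h < e"
          using e t0' by (auto simp: h_def min_def field_simps)
        with e(2)[of h] max[of "t0 + h" x0] show False by auto
      qed
      \<comment> \<open>First and second order conditions for the maximum on each coordinate line:
        together they identify the gradient of \<open>\<phi>\<close> with that of \<open>w\<close>
        and bound the Laplacian of \<open>\<phi>\<close> by \<open>d / s0\<close>.\<close>
      have line: "(G t0 x0 - (x0 - y) /\<^sub>R s0) \<bullet> b = 0" "H t0 x0 b \<bullet> b - 1 / s0 \<le> 0"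
        if b: "b \<in> Basis" for b
      proof -
        define f where "f = (\<lambda>r. F (t0, x0 + r *\<^sub>R b))"
        define f' where "f' = (\<lambda>r. (G t0 (x0 + r *\<^sub>R b) - (x0 + r *\<^sub>R b - y) /\<^sub>R s0) \<bullet> b)"
        have "(f has_real_derivative f' r) (at r)" for r
        proof -
          have dN: "((\<lambda>r. (norm (x0 + r *\<^sub>R b - y))\<^sup>2) has_real_derivative
              2 * ((x0 + r *\<^sub>R b - y) \<bullet> b)) (at r)"
            unfolding power2_norm_eq_inner has_field_derivative_def
            by (auto intro!: derivative_eq_intros simp: inner_commute algebra_simps fun_eq_iff)
          show ?thesis
            unfolding f_def F_def w_def s0_def[symmetric] prod.case
            by (rule DERIV_cong[OF DERIV_diff[OF DERIV_diff[OF GDERIV_along_line[OF phix[OF t0']]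
                    DERIV_add[OF DERIV_add[OF DERIV_add[OF DERIV_const DERIV_cdivide[OF dN]]
                      DERIV_const] DERIV_const]] DERIV_const]])
              (simp add: f'_def inner_diff_left inverse_eq_divide diff_divide_distrib)
        qed
        moreover have "(f' has_real_derivative H t0 x0 b \<bullet> b - 1 / s0) (at 0)"
        proof -
          have "((\<lambda>r. G t0 (x0 + r *\<^sub>R b)) has_derivative (\<lambda>k. H t0 x0 (k *\<^sub>R b))) (at 0)"
            by (rule has_derivative_compose[of "\<lambda>r. x0 + r *\<^sub>R b" _ 0 UNIV "G t0", simplified])
              (use phixx[OF t0'] in \<open>auto intro!: derivative_eq_intros\<close>)
          then show ?thesis
            using \<open>s0 > 0\<close> unfolding f'_def has_field_derivative_def
            by (auto intro!: derivative_eq_intros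
              simp: fun_eq_iff blinfun.scaleR_right inner_diff_left b inverse_eq_divide algebra_simps)
        qed
        moreover have "f r \<le> f 0" for r
          using max[OF t0] by (simp add: f_def)
        ultimately have "f' 0 = 0" "H t0 x0 b \<bullet> b - 1 / s0 \<le> 0"
          by (rule second_derivative_nonpos_at_max)+
        then show "(G t0 x0 - (x0 - y) /\<^sub>R s0) \<bullet> b = 0" "H t0 x0 b \<bullet> b - 1 / s0 \<le> 0"
          by (simp_all add: f'_def)
      qed
      have "G t0 x0 - (x0 - y) /\<^sub>R s0 = 0"
        using line(1) euclidean_all_zero_iff by blast
      then have "norm (G t0 x0) = norm (x0 - y) / s0"
        using \<open>s0 > 0\<close> by (simp add: divide_inverse mult.commute)
      then have "(norm (G t0 x0))\<^sup>2 = (norm (x0 - y))\<^sup>2 / s0\<^sup>2"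
        by (simp add: power_divide)
      moreover have "(\<Sum>b\<in>Basis. H t0 x0 b \<bullet> b) \<le> (\<Sum>b\<in>(Basis :: 'a set). 1 / s0)"
        using line(2) by (intro sum_mono) auto
      then have "\<epsilon> / 2 * (\<Sum>b\<in>Basis. H t0 x0 b \<bullet> b) \<le> \<epsilon> / 2 * (d / s0)"
        using \<open>\<epsilon> > 0\<close> by (intro mult_left_mono) (auto simp: d_def)
      \<comment> \<open>The equation for \<open>\<phi>\<close> now gives
        \<open>dt t0 x0 \<ge> wt\<close>, whereas \<open>time\<close> gives
        \<open>dt t0 x0 \<le> wt - \<eta>\<close>.\<close>
      ultimately show False
        using pde[OF t0', of x0] time \<open>\<eta> > 0\<close> by (simp add: wt_def)
    qed
    have "F (T, x0) \<le> 0"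
    proof -
      \<comment> \<open>Completing the square yields \<open>L * r \<le> r\<^sup>2 / (2 * \<epsilon>)
        + L\<^sup>2 * \<epsilon> / 2\<close>, which is the reason for the last term of
        \<open>w\<close>. The logarithm vanishes at time \<open>T\<close>.\<close>
      define r where "r = norm (x0 - y)"
      have "0 \<le> (r - L * \<epsilon>)\<^sup>2 / (2 * \<epsilon>)"
        using \<open>\<epsilon> > 0\<close> by simp
      also have "\<dots> = r\<^sup>2 / (2 * \<epsilon>) + L\<^sup>2 * \<epsilon> / 2 - L * r"
        using \<open>\<epsilon> > 0\<close> by (simp add: field_simps power2_eq_square)
      finally show ?thesis
        using lip[of x0 y] \<open>\<epsilon> > 0\<close> by (simp add: F_def w_def terminal dist_norm r_def)
    qed
    with max[OF t, of x] have "\<phi> t x \<le> w t x + \<eta> * (T - t)"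
      by (simp add: F_def \<open>t0 = T\<close>)
    also have "\<dots> \<le> w t x + \<eta> * T"
      using t \<open>\<eta> > 0\<close> by simp
    finally show ?thesis .
  qed
  have "\<phi> t x \<le> w t x"
  proof (rule field_le_epsilon)
    fix e :: real assume "e > 0"
    then show "\<phi> t x \<le> w t x + e"
      using strict[of "e / T"] \<open>T > 0\<close> by simp
  qed
  then show ?thesis by (simp add: w_def d_def)
qed

section \<open>Hopf-Lax lower bound for the viscosity solution\<close>

text \<open>
  The function minimized here solves the equation up to the strict term produced by \<open>\<alpha>\<close>, so
  the supersolution property excludes minima before time \<open>T\<close>. Since test functions must be
  smooth on all of \<open>(0,T)\<close>, the pole at \<open>t1\<close> is replaced by a quadratic polynomial in time
  lying above \<open>1 / (t - t1)\<close> near the contact time.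
\<close>

lemma HJ_viscosity_solution_ge_Hopf_Lax:
  fixes g :: "'a::euclidean_space \<Rightarrow> real"
  assumes sol: "HJ_viscosity_solution T g u"
    and t1: "0 \<le> t1" "t1 < T" and t: "t1 < t" "t \<le> T" and "\<alpha> > 0"
  obtains y where "g y + (norm (x1 - y))\<^sup>2 / (2 * (T - t1)) \<le> u t x1 + \<alpha> / (t - t1)"
proof -
  \<comment> \<open>Besides giving strictness, \<open>\<alpha>\<close> keeps \<open>q\<close>
    positive, so that \<open>F\<close> blows up at the pole \<open>s = t1\<close> even on the line
    \<open>x = x1\<close>.\<close>
  define q where "q = (\<lambda>x. (norm (x - x1))\<^sup>2 / 2 + \<alpha>)"
  define F where "F = (\<lambda>(s, x). u s x + q x / (s - t1))"
  have q: "q x \<ge> \<alpha>" for x by (simp add: q_def)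
  from sol obtain K where K: "K-lipschitz_on ({0..T} \<times> UNIV) (\<lambda>(t, x). u t x)"
    and terminal: "\<And>x. u T x = g x"
    and super: "viscosity_supersolution T (\<lambda>(t, x). u t x)"
    unfolding HJ_viscosity_solution_def by blast
  have "K \<ge> 0" using lipschitz_on_nonneg[OF K] .
  have u_lower: "u T x1 - K * T - K * norm (x - x1) \<le> u s x" if "s \<in> {0..T}" for s x
  proof -
    have "dist (T, x1) (s, x) \<le> dist T s + dist x1 x"
      by (simp add: dist_Pair_Pair sqrt_sum_squares_le_sum)
    also have "\<dots> \<le> T + norm (x - x1)"
      using that by (auto simp: dist_norm norm_minus_commute)
    finally have "K * dist (T, x1) (s, x) \<le> K * (T + norm (x - x1))"
      using \<open>K \<ge> 0\<close> by (rule mult_left_mono)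
    moreover have "dist (u T x1) (u s x) \<le> K * dist (T, x1) (s, x)"
      using lipschitz_onD[OF K, of "(T, x1)" "(s, x)"] that by auto
    ultimately show ?thesis
      by (simp add: dist_real_def algebra_simps)
  qed
  \<comment> \<open>The linear loss \<open>K * r\<close> is absorbed by the kernel through a
    completed square, leaving a bound that is uniform in \<open>x\<close> and retains the blow-up
    \<open>\<alpha> / (s - t1)\<close>.\<close>
  have F_lower: "u T x1 - K * T - K\<^sup>2 * T / 2 + \<alpha> / (s - t1) \<le> F (s, x)"
    if s: "t1 < s" "s \<le> T" for s x
  proof -
    define r where "r = norm (x - x1)"
    have "0 \<le> (r - K * (s - t1))\<^sup>2 / (2 * (s - t1))"
      using s by simp
    also have "\<dots> = r\<^sup>2 / (2 * (s - t1)) + K\<^sup>2 * (s - t1) / 2 - K * r"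
      using s by (simp add: field_simps power2_eq_square)
    also have "\<dots> \<le> r\<^sup>2 / (2 * (s - t1)) + K\<^sup>2 * T / 2 - K * r"
      using s t1 by (auto intro!: mult_left_mono)
    finally show ?thesis
      using u_lower[of s x] s t1 by (simp add: F_def q_def r_def add_divide_distrib)
  qed
  \<comment> \<open>\<open>c\<close> exceeds the gap between \<open>F (T, x1)\<close> and the
    constant in \<open>F_lower\<close>. For \<open>s - t1 \<le> \<alpha> / c\<close> the pole term
    is at least \<open>c\<close>, so no minimum lies there. The minimum with \<open>t - t1\<close>
    keeps the time \<open>t\<close> inside \<open>{a..T}\<close>.\<close>
  define c where "c = \<bar>F (T, x1) - (u T x1 - K * T - K\<^sup>2 * T / 2)\<bar> + 1"
  define a where "a = t1 + min (\<alpha> / c) (t - t1)"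
  have "c > 0" by (simp add: c_def)
  have a: "t1 < a" "a \<le> t"
    using t \<open>\<alpha> > 0\<close> \<open>c > 0\<close> by (auto simp: a_def)
  have near_pole: "F (T, x1) < F (s, x)" if "t1 < s" "s \<le> a" for s x
  proof -
    have "s - t1 \<le> \<alpha> / c"
      using that by (auto simp: a_def)
    then have "c \<le> \<alpha> / (s - t1)"
      using that \<open>c > 0\<close> by (simp add: field_simps)
    then show ?thesis
      using F_lower[of s x] that a t unfolding c_def by linarith
  qed
  have contF: "continuous_on ({a..T} \<times> UNIV) (\<lambda>z. - F z)"
  proof -
    have "continuous_on ({a..T} \<times> UNIV) (\<lambda>(t, x). u t x)"
      by (rule continuous_on_subset[OF lipschitz_on_continuous_on[OF K]]) (use a t1 in auto)
    then show ?thesis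
      unfolding F_def q_def case_prod_unfold using a by (auto intro!: continuous_intros)
  qed
  have boundF: "- F (s, x) \<le> (K * T - u T x1) + K * norm (x - x1)
      - 1 / (2 * (T - t1)) * (norm (x - x1))\<^sup>2"
    if s: "s \<in> {a..T}" for s x
  proof -
    have "1 / (2 * (T - t1)) * (norm (x - x1))\<^sup>2 \<le> (norm (x - x1))\<^sup>2 / (2 * (s - t1))"
      using s a by (simp add: divide_left_mono)
    also have "\<dots> \<le> q x / (s - t1)"
      using s a \<open>\<alpha> > 0\<close> by (simp add: q_def add_divide_distrib)
    finally show ?thesis
      using u_lower[of s x] s a t1 by (simp add: F_def)
  qed
  have pos: "a \<le> T" "0 < 1 / (2 * (T - t1))"
    using a t t1 by auto
  obtain t0 x0 where t0: "t0 \<in> {a..T}"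
    and "\<And>s x. s \<in> {a..T} \<Longrightarrow> - F (s, x) \<le> - F (t0, x0)"
    using coercive_attains_sup[of a T "\<lambda>z. - F z", OF contF pos boundF] by blast
  then have min: "\<And>s x. s \<in> {a..T} \<Longrightarrow> F (t0, x0) \<le> F (s, x)"
    by simp
  \<comment> \<open>\<open>near_pole\<close> excludes \<open>t0 \<le> a\<close>. For
    \<open>a < t0 < T\<close> the test function touches \<open>u\<close> from below, and its
    residual in the equation is \<open>- \<alpha> / b\<^sup>2 < 0\<close>, against the supersolution
    property.\<close>
  have "t0 = T"
  proof (rule ccontr)
    assume "t0 \<noteq> T"
    have "F (t0, x0) \<le> F (T, x1)"
      using min[of T x1] a t by simp
    with near_pole[of t0 x0] t0 a have "a < t0"
      by force
    with \<open>t0 \<noteq> T\<close> t0 have t0': "a < t0" "t0 < T" by auto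
    define b where "b = t0 - t1"
    have "b > 0" using t0' a by (simp add: b_def)
    \<comment> \<open>The second order Taylor polynomial of \<open>1 / (s - t1)\<close> at
      \<open>t0\<close>, with its quadratic coefficient doubled. Value and slope at
      \<open>t0\<close> are kept, while the doubling puts \<open>k\<close> above the pole function
      for \<open>s > t0 - b / 2\<close>.\<close>
    define k where "k = (\<lambda>s. 1 / b - (s - t0) / b\<^sup>2 + 2 * (s - t0)\<^sup>2 / b ^ 3)"
    define k' where "k' = (\<lambda>s. - 1 / b\<^sup>2 + 4 * (s - t0) / b ^ 3)"
    have k_above: "1 / (s - t1) \<le> k s" if "s > t0 - b / 2" for s
    proof -
      define h where "h = s - t0"
      have h: "b + h > b / 2" "b + h > 0" using that \<open>b > 0\<close> by (auto simp: h_def)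
      have "k s = (b\<^sup>2 - b * h + 2 * h\<^sup>2) / b ^ 3"
        using \<open>b > 0\<close> unfolding k_def h_def[symmetric]
        by (simp add: field_simps power2_eq_square power3_eq_cube)
      also have "\<dots> - 1 / (b + h) = ((b\<^sup>2 - b * h + 2 * h\<^sup>2) * (b + h) - 1 * b ^ 3) / (b ^ 3 * (b + h))"
        using h \<open>b > 0\<close> by (intro diff_frac_eq) auto
      also have "(b\<^sup>2 - b * h + 2 * h\<^sup>2) * (b + h) - 1 * b ^ 3 = h\<^sup>2 * (b + 2 * h)"
        by algebra
      finally have "k s - 1 / (b + h) = h\<^sup>2 * (b + 2 * h) / (b ^ 3 * (b + h))" .
      moreover have "0 \<le> h\<^sup>2 * (b + 2 * h) / (b ^ 3 * (b + h))"
        using h \<open>b > 0\<close> by simp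
      ultimately have "1 / (b + h) \<le> k s" by linarith
      then show ?thesis by (simp add: h_def b_def)
    qed
    define \<psi> where "\<psi> = (\<lambda>(s, x). - k s * q x)"
    define dt where "dt = (\<lambda>(s, x). - k' s * q x)"
    define G where "G = (\<lambda>(s, x). - k s *\<^sub>R (x - x1))"
    have "has_C1_derivs T \<psi> dt G"
      unfolding has_C1_derivs_def
    proof (intro conjI ballI)
      fix z :: "real \<times> 'a"
      obtain s x where z: "z = (s, x)" by (cases z)
      have "((\<lambda>z. k (fst z)) has_derivative (\<lambda>h. fst h * k' s)) (at z)"
        unfolding k_def k'_def z using \<open>b > 0\<close>
        by (auto intro!: derivative_eq_intros simp: fun_eq_iff field_simps power2_eq_square power3_eq_cube)
      moreover have "((\<lambda>z. q (snd z)) has_derivative (\<lambda>h. snd h \<bullet> (x - x1))) (at z)"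
        unfolding q_def z power2_norm_eq_inner
        by (auto intro!: derivative_eq_intros simp: fun_eq_iff inner_commute)
      ultimately have "((\<lambda>z. - k (fst z) * q (snd z)) has_derivative
          (\<lambda>h. - k s * (snd h \<bullet> (x - x1)) + - (fst h * k' s) * q x)) (at z)"
        by (auto intro!: derivative_eq_intros simp: z fun_eq_iff)
      then show "GDERIV \<psi> z :> (dt z, G z)"
        unfolding gderiv_def \<psi>_def dt_def G_def z case_prod_unfold
        by (simp add: inner_prod_def algebra_simps)
    next
      show "continuous_on ({0<..<T} \<times> UNIV) dt"
        unfolding dt_def k'_def q_def case_prod_unfold using \<open>b > 0\<close>
        by (auto intro!: continuous_intros)
      show "continuous_on ({0<..<T} \<times> UNIV) G"
        unfolding G_def k_def case_prod_unfold using \<open>b > 0\<close>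
        by (auto intro!: continuous_intros)
    qed
    moreover have "(t0, x0) \<in> {0<..<T} \<times> UNIV"
      using t0' a t1 by simp
    moreover have "\<forall>\<^sub>F w in nhds (t0, x0).
        (case w of (s, x) \<Rightarrow> u s x) - \<psi> w \<ge> (case (t0, x0) of (s, x) \<Rightarrow> u s x) - \<psi> (t0, x0)"
    proof -
      have "\<forall>\<^sub>F w in nhds (t0, x0). w \<in> {max a (t0 - b / 2)<..<T} \<times> (UNIV :: 'a set)"
        by (rule eventually_nhds_in_open) (use t0' \<open>b > 0\<close> in \<open>auto intro!: open_Times\<close>)
      then show ?thesis
      proof eventually_elim
        case (elim w)
        obtain s x where w: "w = (s, x)" by (cases w)
        have s: "a < s" "s > t0 - b / 2" "s < T" using elim w by auto
        have "u t0 x0 - \<psi> (t0, x0) = F (t0, x0)"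
          by (simp add: \<psi>_def k_def F_def b_def)
        also have "\<dots> \<le> F (s, x)"
          using min[of s x] s by simp
        also have "\<dots> = u s x + 1 / (s - t1) * q x"
          by (simp add: F_def)
        also have "\<dots> \<le> u s x + k s * q x"
          using k_above[of s] s q[of x] \<open>\<alpha> > 0\<close> by (intro add_left_mono mult_right_mono) auto
        finally show ?case by (simp add: w \<psi>_def)
      qed
    qed
    ultimately have "0 \<le> - dt (t0, x0) + 1 / 2 * (norm (G (t0, x0)))\<^sup>2"
      using super unfolding viscosity_supersolution_def by blast
    also have "(norm (G (t0, x0)))\<^sup>2 = (norm (x0 - x1))\<^sup>2 / b\<^sup>2"
      by (simp add: G_def k_def power_divide)
    also have "dt (t0, x0) = q x0 / b\<^sup>2"
      by (simp add: dt_def k'_def)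
    also have "- (q x0 / b\<^sup>2) + 1 / 2 * ((norm (x0 - x1))\<^sup>2 / b\<^sup>2) = - \<alpha> / b\<^sup>2"
      by (simp add: q_def add_divide_distrib)
    also have "\<dots> < 0"
      using \<open>\<alpha> > 0\<close> \<open>b > 0\<close> by simp
    finally show False by simp
  qed
  \<comment> \<open>The spatial minimizer \<open>x0\<close> at time \<open>T\<close> serves as the
    witness \<open>y\<close>: minimality is compared with the point \<open>(t, x1)\<close>, where
    \<open>q\<close> reduces to \<open>\<alpha>\<close>.\<close>
  have "g x0 + (norm (x1 - x0))\<^sup>2 / (2 * (T - t1)) \<le> F (T, x0)"
    using \<open>\<alpha> > 0\<close> t1 by (simp add: F_def q_def terminal norm_minus_commute add_divide_distrib)
  also have "\<dots> \<le> F (t, x1)"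
    using min[of t x1] \<open>t0 = T\<close> a t by simp
  also have "\<dots> = u t x1 + \<alpha> / (t - t1)"
    by (simp add: F_def q_def)
  finally show thesis by (rule that)
qed

section \<open>From the essential gradient bound to a Lipschitz constant\<close>

text \<open>Translations preserve negligible sets. The detour through \<open>lebesgue\<close>
  handles predicates \<open>P\<close> that are not assumed measurable, such as the existence of a
  gradient.\<close>

lemma AE_lborel_translation:
  fixes v :: "'a::euclidean_space"
  assumes "AE z in lborel. P z"
  shows "AE z in lborel. P (z + v)"
proof -
  have "negligible {z. \<not> P z}"
    using AE_completion[OF assms]
    by (auto simp: eventually_ae_filter negligible_iff_null_sets[symmetric] intro: negligible_subset)
  then have "negligible ((+) (- v) ` {z. \<not> P z})"
    by (rule negligible_translation)
  also have "(+) (- v) ` {z. \<not> P z} = {z. \<not> P (z + v)}"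
    by (auto simp: image_iff intro!: exI[of _ "_ + v"])
  finally have "AE z in lebesgue. P (z + v)"
    by (auto simp: negligible_iff_null_sets eventually_ae_filter)
  then show ?thesis by (simp add: AE_completion_iff)
qed

text \<open>Points without a gradient carry the value \<open>\<infinity>\<close>, so a finite
  essential supremum forces them into a null set.\<close>

lemma AE_gradient_bound:
  assumes "grad_Linf g = ereal L"
  shows "AE z in lborel. \<exists>D. GDERIV g z :> D \<and> norm D \<le> L"
proof -
  define f where "f = (\<lambda>x. if \<exists>D. GDERIV g x :> D then ereal (norm (gradient g x)) else \<infinity>)"
  have "AE x in lebesgue. f x \<le> ereal L"
    using esssup_AE[of f lebesgue] assms by (simp add: grad_Linf_def f_def)
  then have "AE x in lborel. f x \<le> ereal L"
    by (simp add: AE_completion_iff)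
  then show ?thesis
  proof eventually_elim
    case (elim z)
    then obtain D where D: "GDERIV g z :> D"
      by (auto simp: f_def split: if_splits)
    have "D' = D" if "GDERIV g z :> D'" for D'
      using has_derivative_unique[OF that[unfolded gderiv_def] D[unfolded gderiv_def]]
      by (metis inner_commute vector_eq_rdot)
    with D have "gradient g z = D"
      unfolding gradient_def by blast
    then show ?case
      using elim D by (auto simp: f_def split: if_splits)
  qed
qed

text \<open>
  Averages of \<open>g\<close> over a small ball are differentiable along every line even though \<open>g\<close> might
  have no gradient at any point of that line.
\<close>

lemma grad_Linf_lipschitz:
  fixes g :: "'a::euclidean_space \<Rightarrow> real"
  assumes lip: "K-lipschitz_on UNIV g" and L: "grad_Linf g = ereal L"
  shows "g x - g y \<le> L * dist x y"
proof (rule field_le_epsilon)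
  fix e :: real assume "e > 0"
  have "K \<ge> 0" using lipschitz_on_nonneg[OF lip] .
  have lipK: "\<bar>g a - g b\<bar> \<le> K * norm (a - b)" for a b
    using lipschitz_onD[OF lip, of a b] by (simp add: dist_norm)
  have [measurable]: "g \<in> borel_measurable borel"
    by (rule borel_measurable_continuous_onI[OF lipschitz_on_continuous_on[OF lip]])
  have contg: "continuous_on S g" for S
    by (rule continuous_on_subset[OF lipschitz_on_continuous_on[OF lip]]) simp
  \<comment> \<open>Moving an evaluation point by at most \<open>r\<close> changes \<open>g\<close>
    by at most \<open>K * r\<close>. Two such errors must fit into \<open>e\<close>; the denominator
    uses \<open>K + 1\<close> because \<open>K\<close> may be \<open>0\<close>.\<close>
  define r where "r = e / (2 * (K + 1))"
  have "r > 0" using \<open>e > 0\<close> \<open>K \<ge> 0\<close> by (simp add: r_def)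
  have r: "2 * K * r \<le> e"
    using \<open>e > 0\<close> \<open>K \<ge> 0\<close> by (simp add: r_def field_simps)
  define Q where "Q = cball (0::'a) r"
  define m where "m = measure lborel Q"
  have "m > 0"
    using content_cball_pos[OF \<open>r > 0\<close>] by (simp add: m_def Q_def measure_completion)
  have [measurable]: "Q \<in> sets borel" by (simp add: Q_def)
  have int: "integrable lborel (\<lambda>z. indicator Q z * f z)" if "continuous_on UNIV f" for f :: "'a \<Rightarrow> real"
    using borel_integrable_compact[of Q f] continuous_on_subset[OF that]
    by (simp add: Q_def set_integrable_def)
  define h where "h = x - y"
  \<comment> \<open>Unnormalized averages of \<open>g\<close> over balls whose centre moves from
    \<open>y\<close> at \<open>s = 0\<close> to \<open>x\<close> at \<open>s = 1\<close>.\<close>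
  define A where "A = (\<lambda>s. \<integral>z. indicator Q z * g (z + (y + s *\<^sub>R h)) \<partial>lborel)"
  have intA: "integrable lborel (\<lambda>z. indicator Q z * g (z + v))" for v
    by (rule int) (auto intro!: continuous_on_compose2[OF contg[of UNIV]] continuous_intros)
  have deriv: "\<exists>l. (A has_real_derivative l) (at s) \<and> l \<le> L * norm h * m" for s
  proof -
    define v where "v = y + s *\<^sub>R h"
    define dq where "dq = (\<lambda>k z. (g (z + v + k *\<^sub>R h) - g (z + v)) / k)"
    \<comment> \<open>Defined as a limit along a fixed sequence, \<open>D\<close> is measurable
      everywhere; it agrees with the directional derivative almost everywhere.\<close>
    define D where "D = (\<lambda>z. lim (\<lambda>n. dq (1 / real (Suc n)) z))"
    have [measurable]: "dq k \<in> borel_measurable borel" for k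
      unfolding dq_def by measurable
    have [measurable]: "D \<in> borel_measurable borel"
      unfolding D_def by measurable
    have dq_bound: "\<bar>dq k z\<bar> \<le> K * norm h" for k z
    proof (cases "k = 0")
      case False
      then show ?thesis
        using lipK[of "z + v + k *\<^sub>R h" "z + v"] by (simp add: dq_def field_simps)
    qed (use \<open>K \<ge> 0\<close> in \<open>simp add: dq_def\<close>)
    have ae: "AE z in lborel. ((\<lambda>k. dq k z) \<longlongrightarrow> D z) (at 0) \<and> D z \<le> L * norm h"
      using AE_lborel_translation[OF AE_gradient_bound[OF L], of v]
    proof eventually_elim
      case (elim z)
      then obtain E where E: "GDERIV g (z + v) :> E" "norm E \<le> L" by blast
      have "((\<lambda>k. g (z + v + k *\<^sub>R h)) has_real_derivative E \<bullet> h) (at 0)"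
        by (rule GDERIV_along_line) (use E in simp)
      then have lim: "((\<lambda>k. dq k z) \<longlongrightarrow> E \<bullet> h) (at 0)"
        by (simp add: DERIV_def dq_def)
      have "filterlim (\<lambda>n. 1 / real (Suc n)) (at 0) sequentially"
        using LIMSEQ_Suc[OF lim_1_over_n] by (auto simp: filterlim_at)
      then have "(\<lambda>n. dq (1 / real (Suc n)) z) \<longlonglongrightarrow> E \<bullet> h"
        by (rule filterlim_compose[OF lim])
      then have "D z = E \<bullet> h"
        unfolding D_def by (rule limI)
      moreover have "E \<bullet> h \<le> L * norm h"
        using norm_cauchy_schwarz[of E h] mult_right_mono[OF E(2), of "norm h"] by simp
      ultimately show ?case using lim by simp
    qed
    have intc: "integrable lborel (\<lambda>z. indicator Q z * c)" for c :: real
      by (rule int) simp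
    \<comment> \<open>Differentiation under the integral by dominated convergence along sequences,
      with the Lipschitz bound \<open>dq_bound\<close> as majorant.\<close>
    have "((\<lambda>k. (A (s + k) - A s) / k) \<longlongrightarrow> (\<integral>z. indicator Q z * D z \<partial>lborel)) (at 0)"
      unfolding tendsto_at_iff_sequentially
    proof (intro allI impI)
      fix X :: "nat \<Rightarrow> real"
      assume X: "\<forall>i. X i \<in> UNIV - {0}" "X \<longlonglongrightarrow> 0"
      have "(\<lambda>i. \<integral>z. indicator Q z * dq (X i) z \<partial>lborel) \<longlonglongrightarrow> (\<integral>z. indicator Q z * D z \<partial>lborel)"
      proof (rule integral_dominated_convergence[where w = "\<lambda>z. indicator Q z * (K * norm h)"])
        show "AE z in lborel. (\<lambda>i. indicator Q z * dq (X i) z) \<longlonglongrightarrow> indicator Q z * D z"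
          using ae
        proof eventually_elim
          case (elim z)
          then have "(\<lambda>i. dq (X i) z) \<longlonglongrightarrow> D z"
            using X unfolding tendsto_at_iff_sequentially comp_def by blast
          then show ?case by (intro tendsto_intros)
        qed
        show "AE z in lborel. norm (indicator Q z * dq (X i) z) \<le> indicator Q z * (K * norm h)" for i
          using dq_bound by (auto simp: indicator_def)
        show "integrable lborel (\<lambda>z. indicator Q z * (K * norm h))"
          by (rule intc)
      qed measurable
      moreover have "(\<integral>z. indicator Q z * dq k z \<partial>lborel) = (A (s + k) - A s) / k" for k
      proof -
        have "(\<lambda>z. indicator Q z * dq k z) = (\<lambda>z. (indicator Q z * g (z + (y + (s + k) *\<^sub>R h))
            - indicator Q z * g (z + (y + s *\<^sub>R h))) / k)"
          by (simp add: fun_eq_iff dq_def v_def algebra_simps diff_divide_distrib)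
        then show ?thesis
          using intA by (simp add: A_def)
      qed
      ultimately show "((\<lambda>k. (A (s + k) - A s) / k) \<circ> X) \<longlonglongrightarrow> (\<integral>z. indicator Q z * D z \<partial>lborel)"
        by (simp add: comp_def)
    qed
    moreover have "(\<integral>z. indicator Q z * D z \<partial>lborel) \<le> (\<integral>z. indicator Q z * (L * norm h) \<partial>lborel)"
    proof (rule integral_mono_AE[OF _ intc])
      have "AE z in lborel. \<bar>D z\<bar> \<le> K * norm h"
        using ae
      proof eventually_elim
        case (elim z)
        then have "((\<lambda>k. \<bar>dq k z\<bar>) \<longlongrightarrow> \<bar>D z\<bar>) (at 0)"
          by (intro tendsto_intros) auto
        then show ?case
          by (rule tendsto_upperbound) (use dq_bound in auto)
      qed
      then show "integrable lborel (\<lambda>z. indicator Q z * D z)"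
        by (intro Bochner_Integration.integrable_bound[OF intc[of "K * norm h"]])
          (auto elim!: eventually_mono simp: indicator_def)
      show "AE z in lborel. indicator Q z * D z \<le> indicator Q z * (L * norm h)"
        using ae by eventually_elim (simp add: indicator_def)
    qed
    moreover have "(\<integral>z. indicator Q z * (L * norm h) \<partial>lborel) = L * norm h * m"
      by (simp add: m_def)
    ultimately show ?thesis
      unfolding DERIV_def by metis
  qed
  then obtain l where l: "\<And>s. (A has_real_derivative l s) (at s)" "\<And>s. l s \<le> L * norm h * m"
    by metis
  \<comment> \<open>The mean value theorem turns the pointwise bound on \<open>l\<close> into one on
    \<open>A 1 - A 0\<close>.\<close>
  obtain s where "A 1 - A 0 = (1 - 0) * l s"
    using MVT2[of 0 1 A l] l(1) by auto
  then have upper: "A 1 - A 0 \<le> L * norm h * m"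
    using l(2) by simp
  have "m * (g x - g y - e) = (\<integral>z. indicator Q z * (g x - g y - e) \<partial>lborel)"
    by (simp add: m_def)
  also have "\<dots> \<le> (\<integral>z. indicator Q z * g (z + x) - indicator Q z * g (z + y) \<partial>lborel)"
  proof (rule integral_mono)
    show "integrable lborel (\<lambda>z. indicator Q z * (g x - g y - e))"
      by (rule int) simp
    show "integrable lborel (\<lambda>z. indicator Q z * g (z + x) - indicator Q z * g (z + y))"
      by (intro Bochner_Integration.integrable_diff intA)
    fix z
    have "g x - g y - e \<le> g (z + x) - g (z + y)" if "z \<in> Q"
    proof -
      have "K * norm z \<le> K * r"
        using that \<open>K \<ge> 0\<close> by (intro mult_left_mono) (auto simp: Q_def)
      then show ?thesis
        using lipK[of "z + x" x] lipK[of "z + y" y] r by (simp add: abs_le_iff)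
    qed
    then show "indicator Q z * (g x - g y - e) \<le> indicator Q z * g (z + x) - indicator Q z * g (z + y)"
      by (simp add: indicator_def)
  qed
  also have "\<dots> = A 1 - A 0"
    using intA[of x] intA[of y] by (simp add: A_def h_def)
  finally have "m * (g x - g y - e) \<le> m * (L * norm h)"
    using upper by (simp add: mult.commute mult.left_commute)
  then show "g x - g y \<le> L * dist x y + e"
    using \<open>m > 0\<close> by (simp add: h_def dist_norm)
qed

section \<open>Combination of the two bounds\<close>

theorem proposition3p2:
  fixes T L :: real
  assumes "T > 0"
  shows "\<exists>C>0. \<forall>g :: real ^ 'd \<Rightarrow> real.
           (\<exists>K. K-lipschitz_on UNIV g) \<and> grad_Linf g = ereal L \<longrightarrow>
           (\<forall>\<phi>0. HJ_viscosity_solution T g \<phi>0 \<longrightarrow>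
             (\<forall>\<epsilon>\<in>{0<..1/2}. \<forall>\<phi>\<epsilon>. viscous_HJ_solution \<epsilon> T g \<phi>\<epsilon> \<longrightarrow>
               (\<forall>t\<in>{0..T}. \<forall>x.
                  \<phi>\<epsilon> t x - \<phi>0 t x \<le> - (real CARD('d) / 2) * \<epsilon> * ln \<epsilon> + C * \<epsilon>)))"
proof -
  \<comment> \<open>\<open>L\<^sup>2 / 2\<close> comes from the kernel bound, and
    \<open>\<epsilon> \<le> 1/2\<close> gives
    \<open>ln (T - t + \<epsilon>) \<le> ln (T + 1/2)\<close>, possibly negative, hence the absolute
    value. The summand \<open>1\<close> secures positivity.\<close>
  define C where "C = L\<^sup>2 / 2 + real CARD('d) / 2 * \<bar>ln (T + 1/2)\<bar> + 1"
  have "C > 0" by (auto simp: C_def intro!: add_nonneg_pos)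
  moreover have "\<phi>\<epsilon> t x - \<phi>0 t x \<le> - (real CARD('d) / 2) * \<epsilon> * ln \<epsilon> + C * \<epsilon>"
    if lip: "\<exists>K. K-lipschitz_on UNIV g" and L: "grad_Linf g = ereal L"
      and sol0: "HJ_viscosity_solution T g \<phi>0" and \<epsilon>: "\<epsilon> \<in> {0<..1/2}"
      and sol\<epsilon>: "viscous_HJ_solution \<epsilon> T g \<phi>\<epsilon>" and t: "t \<in> {0..T}"
    for g :: "real ^ 'd \<Rightarrow> real" and \<phi>0 \<phi>\<epsilon> \<epsilon> t x
  proof -
    have "\<epsilon> > 0" using \<epsilon> by simp
    have upper: "\<phi>\<epsilon> t x \<le> g y + (norm (x - y))\<^sup>2 / (2 * (T - t + \<epsilon>))
        + (- (real CARD('d) / 2) * \<epsilon> * ln \<epsilon> + C * \<epsilon>)" for y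
    proof -
      have "ln (T - t + \<epsilon>) \<le> \<bar>ln (T + 1/2)\<bar>"
        using ln_mono[of "T - t + \<epsilon>" "T + 1/2"] t \<epsilon> by (auto intro: order_trans[OF _ abs_ge_self])
      moreover have "ln ((T - t + \<epsilon>) / \<epsilon>) = ln (T - t + \<epsilon>) - ln \<epsilon>"
        using t \<open>\<epsilon> > 0\<close> by (simp add: ln_div)
      ultimately have "\<epsilon> * real CARD('d) / 2 * ln ((T - t + \<epsilon>) / \<epsilon>)
          \<le> \<epsilon> * real CARD('d) / 2 * (\<bar>ln (T + 1/2)\<bar> - ln \<epsilon>)"
        using \<open>\<epsilon> > 0\<close> by (intro mult_left_mono) auto
      then have "\<epsilon> * real CARD('d) / 2 * ln ((T - t + \<epsilon>) / \<epsilon>) + L\<^sup>2 * \<epsilon> / 2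
          \<le> - (real CARD('d) / 2) * \<epsilon> * ln \<epsilon> + C * \<epsilon>"
        using \<open>\<epsilon> > 0\<close> by (simp add: C_def algebra_simps)
      moreover have "\<phi>\<epsilon> t x \<le> g y + (norm (x - y))\<^sup>2 / (2 * (T - t + \<epsilon>))
          + \<epsilon> * real DIM(real ^ 'd) / 2 * ln ((T - t + \<epsilon>) / \<epsilon>) + L\<^sup>2 * \<epsilon> / 2"
        using lip grad_Linf_lipschitz[OF _ L]
        by (intro viscous_HJ_solution_le_heat_kernel[OF sol\<epsilon> \<open>T > 0\<close> \<open>\<epsilon> > 0\<close> _ t]) blast
      ultimately show ?thesis by simp
    qed
    show ?thesis
    proof (cases "t = T")
      case True
      with sol0 have "\<phi>0 t x = g x"
        by (simp add: HJ_viscosity_solution_def)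
      with upper[of x] show ?thesis by simp
    next
      case False
      with t have "t < T" by simp
      from sol0 obtain K where K: "K-lipschitz_on ({0..T} \<times> UNIV) (\<lambda>(t, x). \<phi>0 t x)"
        unfolding HJ_viscosity_solution_def by blast
      let ?E = "- (real CARD('d) / 2) * \<epsilon> * ln \<epsilon> + C * \<epsilon>"
      \<comment> \<open>The Hopf-Lax bound with its pole at time \<open>t\<close> speaks of strictly
        later times, so it is applied at \<open>t + \<delta>\<close>. Taking
        \<open>\<alpha> = \<delta>\<^sup>2\<close> makes its error \<open>\<delta>\<close>, and
        returning to time \<open>t\<close> costs \<open>K * \<delta>\<close>.\<close>
      have step: "\<phi>\<epsilon> t x - \<phi>0 t x \<le> ?E + (K + 1) * \<delta>" if \<delta>: "\<delta> > 0" "\<delta> \<le> T - t" for \<delta>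
      proof -
        obtain y where y: "g y + (norm (x - y))\<^sup>2 / (2 * (T - t)) \<le> \<phi>0 (t + \<delta>) x + \<delta>\<^sup>2 / (t + \<delta> - t)"
          using HJ_viscosity_solution_ge_Hopf_Lax[OF sol0, of t "t + \<delta>" "\<delta>\<^sup>2" x] t \<open>t < T\<close> \<delta> by auto
        \<comment> \<open>The delay by \<open>\<epsilon>\<close> only lowers the quadratic term, so
          the same \<open>y\<close> serves in both bounds.\<close>
        have "(norm (x - y))\<^sup>2 / (2 * (T - t + \<epsilon>)) \<le> (norm (x - y))\<^sup>2 / (2 * (T - t))"
          using \<open>t < T\<close> \<open>\<epsilon> > 0\<close> by (intro divide_left_mono) auto
        moreover have "\<phi>0 (t + \<delta>) x - \<phi>0 t x \<le> K * \<delta>"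
          using lipschitz_onD[OF K, of "(t + \<delta>, x)" "(t, x)"] t \<delta>
          by (auto simp: dist_Pair_Pair dist_real_def)
        ultimately show ?thesis
          using upper[of y] y \<delta> by (simp add: algebra_simps power2_eq_square)
      qed
      show ?thesis
      proof (rule field_le_epsilon)
        fix e :: real assume "e > 0"
        have "K \<ge> 0" using lipschitz_on_nonneg[OF K] .
        define \<delta> where "\<delta> = min (T - t) (e / (K + 1))"
        have "\<delta> > 0" "\<delta> \<le> T - t"
          using \<open>t < T\<close> \<open>e > 0\<close> \<open>K \<ge> 0\<close> by (auto simp: \<delta>_def)
        moreover have "(K + 1) * \<delta> \<le> (K + 1) * (e / (K + 1))"
          using \<open>K \<ge> 0\<close> by (intro mult_left_mono) (auto simp: \<delta>_def)
        ultimately show "\<phi>\<epsilon> t x - \<phi>0 t x \<le> ?E + e"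
          using step[of \<delta>] \<open>K \<ge> 0\<close> by simp
      qed
    qed
  qed
  ultimately show ?thesis by blast
qed

end
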